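(* Let $t\ge 1$, let $k\in[2^{t-1},2^t)$ be an integer and let $n\ge t+1$. Let the $(n-1)$-digit binary expansion of $k$ consist of $n-t-1$ zeros followed by a block of $t$ binary digits beginning with $1$, and let $1=s_1<s_2<\dots<s_m\le t$ be the places of the $1$'s within this block of $t$ digits (counted from the left, the first digit of the block having place $1$). Then $\left\{{n \atop k}\right\}$ equals the determinant of order $m+1$ $$\left\{{n \atop k}\right\}=\begin{vmatrix} 1&1&0&0&\cdots&0\\ 1&\binom{n-t+s_2-1}{s_2-1}&1&0&\cdots&0\\ 1&\binom{n-t+s_3-1}{s_3-1}&\binom{n-t+s_3-1}{s_3-s_2}&1&\cdots&0\\ \vdots&\vdots&\vdots&\vdots&&\vdots\\ 1&\binom{n-t+s_m-1}{s_m-1}&\binom{n-t+s_m-1}{s_m-s_2}&\binom{n-t+s_m-1}{s_m-s_3}&\cdots&1\\ 1&\binom{n}{t}&\binom{n}{t+1-s_2}&\binom{n}{t+1-s_3}&\cdots&\binom{n}{t+1-s_m} \end{vmatrix}.$$ That is, for $1\le i\le m$ the $i$-th row has first entry $1$, entry $\binom{n-t+s_i-1}{s_i-s_{j-1}}$ in column $j$ for $2\le j\le i$, entry $1$ in column $i+1$, and $0$ in later columns; the last row has first entry $1$ and entry $\binom{n}{t+1-s_{j-1}}$ in column $j$ for $2\le j\le m+1$.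
   Context: For a permutation $\pi=(\pi_1,\dots,\pi_n)$ of $1,\dots,n$, put $q'_i=1$ if $\pi_{i+1}>\pi_i$ and $q'_i=0$ if $\pi_{i+1}<\pi_i$ ($1\le i\le n-1$). The index of $\pi$ is the integer $\sum_{i=1}^{n-1}q'_i2^{n-1-i}$. For $n\ge1$ and $0\le k\le 2^{n-1}-1$, $\left\{{n \atop k}\right\}$ denotes the number of permutations of $1,\dots,n$ having index $k$. *)

theory Defs
  imports "HOL-Combinatorics.Permutations" "Jordan_Normal_Form.Determinant"
begin

text \<open>A permutation \<open>(\<pi>\<^sub>1, \<dots>, \<pi>\<^sub>n)\<close> is represented by a function \<open>p\<close> with
  \<open>p permutes {1..n}\<close> and \<open>\<pi>\<^sub>i = p i\<close>. Since \<open>p\<close> is the identity outside \<open>{1..n}\<close>,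
  cardinalities are those of the set of one-line arrangements.\<close>

definition ascent_digit :: "(nat \<Rightarrow> nat) \<Rightarrow> nat \<Rightarrow> nat" where
  "ascent_digit p i = (if p (i + 1) > p i then 1 else 0)"

definition perm_index :: "nat \<Rightarrow> (nat \<Rightarrow> nat) \<Rightarrow> nat" where
  "perm_index n p = (\<Sum>i = 1..n - 1. ascent_digit p i * 2 ^ (n - 1 - i))"

definition perms_with_index :: "nat \<Rightarrow> nat \<Rightarrow> nat" where
  "perms_with_index n k = card {p. p permutes {1..n} \<and> perm_index n p = k}"

text \<open>Rows and columns are numbered from 1 here; \<open>mat\<close> numbers them from 0, hence the
  shift in \<open>index_matrix\<close>.\<close>

definition index_matrix_entry ::
  "nat \<Rightarrow> nat \<Rightarrow> nat \<Rightarrow> (nat \<Rightarrow> nat) \<Rightarrow> nat \<Rightarrow> nat \<Rightarrow> nat" where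
  "index_matrix_entry n t m s i j =
    (if j = 1 then 1
     else if i = m + 1 then n choose (t + 1 - s (j - 1))
     else if j \<le> i then (n - t + s i - 1) choose (s i - s (j - 1))
     else if j = i + 1 then 1
     else 0)"

definition index_matrix :: "nat \<Rightarrow> nat \<Rightarrow> nat \<Rightarrow> (nat \<Rightarrow> nat) \<Rightarrow> int mat" where
  "index_matrix n t m s =
    mat (m + 1) (m + 1) (\<lambda>(i, j). int (index_matrix_entry n t m s (i + 1) (j + 1)))"

end

theory Submission
  imports Defs "HOL-Library.Infinite_Set"
begin

text \<open>
  The index of a permutation is its ascent set written in binary, so the theorem counts
  permutations with a prescribed ascent set \<open>{a\<^sub>1 < \<dots> < a\<^sub>m}\<close>, where \<open>a\<^sub>i = n - t - 1 + s\<^sub>i\<close>.  Put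
  \<open>a\<^sub>0 = 0\<close> and \<open>a\<^sub>m\<^sub>+\<^sub>1 = n\<close>.  By the symmetry of binomial coefficients the entry in row \<open>i\<close>
  and column \<open>j\<close> of the matrix is \<open>a\<^sub>i choose a\<^sub>j\<^sub>-\<^sub>1\<close>; this also covers the ones above the diagonal
  and the zeros beyond them.

  The counts satisfy a recurrence.  Choose which \<open>a\<close> of \<open>N\<close> values come first, arrange them with
  ascent set \<open>S \<subseteq> {1..<a}\<close>, and let the other values follow in decreasing order.  Position \<open>a\<close> is
  the only one that is left free, so the result is any arrangement of \<open>N\<close> values with ascent set
  \<open>S\<close> or \<open>insert a S\<close> (lemma \<open>card_arrangements_insert\<close>).  Let \<open>d\<^sub>i\<close> be the number of arrangements
  of \<open>a\<^sub>i\<close> values with ascent set \<open>{a\<^sub>1, \<dots>, a\<^sub>i\<^sub>-\<^sub>1}\<close>.  Alternating sums of these identities telescope,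
  and give \<open>\<Sum>j\<le>i. (-1)\<^sup>j (a\<^sub>i choose a\<^sub>j) d\<^sub>j = 0\<close> for \<open>i \<ge> 1\<close>.

  So the columns of the matrix, taken with coefficients \<open>(-1)\<^sup>j d\<^sub>j\<close> for \<open>j = 0, \<dots>, m\<close>, add up to
  zero in every row but the last.  There the term \<open>j = m + 1\<close> has no column, and its absence leaves
  \<open>(-1)\<^sup>m d\<^sub>m\<^sub>+\<^sub>1\<close>.  Substituting this combination for the first column does not change the determinant,
  as \<open>d\<^sub>0 = 1\<close>, and expanding along it leaves a unitriangular minor with cofactor sign \<open>(-1)\<^sup>m\<close>
  (lemma \<open>det_Hessenberg\<close>).  Hence the determinant is \<open>d\<^sub>m\<^sub>+\<^sub>1\<close>.
\<close>

section \<open>Arrangements with a given ascent set\<close>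

text \<open>The ascent at positions \<open>i\<close>, \<open>i + 1\<close> of the word, counted from 1, is recorded as \<open>i\<close>; the list
  index of its left letter is therefore \<open>i - 1\<close>. The ground set is left arbitrary since prefixes
  of permutations use arbitrary sets of values.\<close>

definition arrangements :: "nat set \<Rightarrow> nat set \<Rightarrow> nat list set" where
  "arrangements A S = {xs. distinct xs \<and> set xs = A \<and>
     (\<forall>i. Suc i < length xs \<longrightarrow> (xs ! i < xs ! Suc i \<longleftrightarrow> Suc i \<in> S))}"

lemma length_arrangements: "xs \<in> arrangements A S \<Longrightarrow> length xs = card A"
  by (auto simp: arrangements_def distinct_card)

lemma finite_arrangements: "finite A \<Longrightarrow> finite (arrangements A S)"
  by (rule finite_subset[OF _ finite_subset_distinct[of A]]) (auto simp: arrangements_def)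

text \<open>Ascents depend only on the relative order of the letters, so the order isomorphism between
  two ground sets of the same size carries arrangements to arrangements.\<close>

lemma card_arrangements_lessThan:
  assumes "finite A"
  shows "card (arrangements A S) = card (arrangements {..<card A} S)"
proof -
  obtain h where h: "bij_betw h {..<card A} A" and mono: "strict_mono_on {..<card A} h"
    using ex_bij_betw_strict_mono_card[OF assms] by blast
  have inj: "inj_on h {..<card A}" using h by (simp add: bij_betw_def)
  have "arrangements A S = map h ` arrangements {..<card A} S"
  proof (intro equalityI subsetI)
    fix xs assume xs: "xs \<in> arrangements A S"
    define ys where "ys = map (the_inv_into {..<card A} h) xs"
    have inv: "bij_betw (the_inv_into {..<card A} h) A {..<card A}"
      using h by (rule bij_betw_the_inv_into)
    have sxs: "set xs = A" "distinct xs" using xs by (auto simp: arrangements_def)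
    have xs_eq: "xs = map h ys"
      using sxs h by (auto simp: ys_def bij_betw_def f_the_inv_into_f intro!: map_idI[symmetric])
    have sys: "set ys = {..<card A}" "distinct ys"
      using inv sxs by (auto simp: ys_def distinct_map bij_betw_def)
    have "ys ! i < ys ! Suc i \<longleftrightarrow> Suc i \<in> S" if "Suc i < length ys" for i
    proof -
      have "ys ! i \<in> {..<card A}" "ys ! Suc i \<in> {..<card A}"
        using that sys(1) nth_mem[of i ys] nth_mem[of "Suc i" ys] by auto
      hence "ys ! i < ys ! Suc i \<longleftrightarrow> xs ! i < xs ! Suc i"
        using strict_mono_on_less[OF mono] that by (simp add: xs_eq)
      thus ?thesis using xs that by (simp add: arrangements_def xs_eq)
    qed
    hence "ys \<in> arrangements {..<card A} S" using sys by (simp add: arrangements_def)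
    thus "xs \<in> map h ` arrangements {..<card A} S" using xs_eq by blast
  next
    fix xs assume "xs \<in> map h ` arrangements {..<card A} S"
    then obtain ys where ys: "ys \<in> arrangements {..<card A} S" and xs: "xs = map h ys" by blast
    have sys: "set ys = {..<card A}" "distinct ys" using ys by (auto simp: arrangements_def)
    have "xs ! i < xs ! Suc i \<longleftrightarrow> Suc i \<in> S" if "Suc i < length xs" for i
    proof -
      have "ys ! i \<in> {..<card A}" "ys ! Suc i \<in> {..<card A}"
        using that sys(1) nth_mem[of i ys] nth_mem[of "Suc i" ys] by (auto simp: xs)
      hence "xs ! i < xs ! Suc i \<longleftrightarrow> ys ! i < ys ! Suc i"
        using strict_mono_on_less[OF mono] that by (simp add: xs)
      thus ?thesis using ys that by (simp add: arrangements_def xs)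
    qed
    moreover have "set xs = A" "distinct xs"
      using sys h by (auto simp: xs distinct_map bij_betw_def)
    ultimately show "xs \<in> arrangements A S" by (simp add: arrangements_def)
  qed
  moreover have "inj_on (map h) (arrangements {..<card A} S)"
    by (rule inj_on_subset[OF inj_on_map_lists[OF inj]]) (auto simp: arrangements_def)
  ultimately show ?thesis by (simp add: card_image)
qed

text \<open>A word of distinct letters without ascents is decreasing.\<close>

lemma arrangements_empty:
  assumes "finite A"
  shows "arrangements A {} = {rev (sorted_list_of_set A)}"
proof -
  have "xs \<in> arrangements A {} \<longleftrightarrow> xs = rev (sorted_list_of_set A)" for xs
  proof -
    have "xs \<in> arrangements A {} \<longleftrightarrow> sorted (rev xs) \<and> distinct (rev xs) \<and> set (rev xs) = A"
      by (auto simp: arrangements_def sorted_rev_iff_nth_Suc not_less)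
    also have "\<dots> \<longleftrightarrow> rev xs = sorted_list_of_set A"
      using sorted_list_of_set.idem_if_sorted_distinct[of "rev xs"] assms
      by (metis sorted_list_of_set(1-3))
    finally show ?thesis by (metis rev_rev_ident)
  qed
  thus ?thesis by auto
qed

text \<open>The only position that the two factors leave unconstrained is the one where they meet.\<close>

lemma append_mem_arrangements_iff:
  assumes "S \<subseteq> {1..<length xs}"
  shows "xs @ ys \<in> arrangements A S \<union> arrangements A (insert (length xs) S) \<longleftrightarrow>
    set xs \<subseteq> A \<and> xs \<in> arrangements (set xs) S \<and> ys \<in> arrangements (A - set xs) {}"
    (is "?L \<longleftrightarrow> ?R")
proof
  let ?asc = "\<lambda>zs i. zs ! i < zs ! Suc i"
  assume L: ?L
  hence dist: "distinct xs" "distinct ys" "set xs \<inter> set ys = {}" "set xs \<union> set ys = A"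
    by (auto simp: arrangements_def)
  have asc: "?asc (xs @ ys) i \<longleftrightarrow> Suc i \<in> S"
    if "Suc i < length xs + length ys" "Suc i \<noteq> length xs" for i
    using L that by (auto simp: arrangements_def)
  have "?asc xs i \<longleftrightarrow> Suc i \<in> S" if "Suc i < length xs" for i
    using asc[of i] that by (simp add: nth_append)
  moreover have "\<not> ?asc ys i" if "Suc i < length ys" for i
    using asc[of "length xs + i"] that assms by (auto simp: nth_append)
  ultimately show ?R using dist by (auto simp: arrangements_def)
next
  let ?asc = "\<lambda>zs i. zs ! i < zs ! Suc i"
  assume R: ?R
  have asc: "?asc (xs @ ys) i \<longleftrightarrow> Suc i \<in> S"
    if "Suc i < length xs + length ys" "Suc i \<noteq> length xs" for i
  proof (cases "Suc i < length xs")
    case True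
    thus ?thesis using R by (auto simp: arrangements_def nth_append)
  next
    case False
    define j where "j = i - length xs"
    have "i = length xs + j" using False that by (simp add: j_def)
    thus ?thesis using R assms that by (auto simp: arrangements_def nth_append)
  qed
  have base: "distinct (xs @ ys)" "set (xs @ ys) = A" using R by (auto simp: arrangements_def)
  show ?L
  proof (cases "xs \<noteq> [] \<and> ys \<noteq> [] \<and> ?asc (xs @ ys) (length xs - 1)")
    case True
    have "?asc (xs @ ys) i \<longleftrightarrow> Suc i \<in> insert (length xs) S"
      if "Suc i < length (xs @ ys)" for i
    proof (cases "Suc i = length xs")
      case at_end: True
      hence "i = length xs - 1" by simp
      thus ?thesis using True at_end by blast
    qed (use asc[of i] that in auto)
    thus ?thesis using base unfolding arrangements_def by blast
  next
    case False
    have "?asc (xs @ ys) i \<longleftrightarrow> Suc i \<in> S" if "Suc i < length (xs @ ys)" for i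
    proof (cases "Suc i = length xs")
      case True
      hence "i = length xs - 1" "xs \<noteq> []" "ys \<noteq> []" using that by auto
      moreover have "Suc i \<notin> S" using assms True by auto
      ultimately show ?thesis using False by blast
    qed (use asc[of i] that in auto)
    thus ?thesis using base unfolding arrangements_def by blast
  qed
qed

text \<open>Cutting a word after its first \<open>a\<close> letters determines the set \<open>B\<close> of these letters and an
  arrangement of \<open>B\<close>; the decreasing rest can be recovered from \<open>B\<close>. The bound \<open>a < card A\<close> makes
  \<open>a\<close> a genuine ascent position, so that the two sets on the left are disjoint.\<close>

lemma card_arrangements_insert:
  assumes "finite A" and a: "0 < a" "a < card A" and S: "S \<subseteq> {1..<a}"
  shows "card (arrangements A S) + card (arrangements A (insert a S)) =
    (card A choose a) * card (arrangements {..<a} S)"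
proof -
  let ?X = "arrangements A S \<union> arrangements A (insert a S)"
  let ?P = "{B. B \<subseteq> A \<and> card B = a}"
  let ?Q = "SIGMA B:?P. arrangements B S"
  let ?app = "\<lambda>(B, xs). xs @ rev (sorted_list_of_set (A - B))"
  let ?split = "\<lambda>zs. (set (take a zs), take a zs)"
  have fin: "finite ?P" using assms(1) by simp
  have "a \<notin> S" using S by auto
  have disj: "arrangements A S \<inter> arrangements A (insert a S) = {}"
  proof -
    have False if "zs \<in> arrangements A S" "zs \<in> arrangements A (insert a S)" for zs
    proof -
      have "Suc (a - 1) < length zs" using a length_arrangements[OF that(1)] by simp
      hence "Suc (a - 1) \<in> S \<longleftrightarrow> Suc (a - 1) \<in> insert a S"
        using that unfolding arrangements_def by blast
      thus False using \<open>a \<notin> S\<close> a by simp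
    qed
    thus ?thesis by blast
  qed
  \<comment> \<open>cutting after \<open>a\<close> letters and gluing the decreasing rest back on are mutually inverse\<close>
  have "bij_betw ?split ?X ?Q"
  proof (rule bij_betw_byWitness[where f' = ?app])
    have split: "set (take a zs) \<subseteq> A \<and> take a zs \<in> arrangements (set (take a zs)) S \<and>
        drop a zs = rev (sorted_list_of_set (A - set (take a zs))) \<and> card (set (take a zs)) = a"
      if "zs \<in> ?X" for zs
    proof -
      have len: "length zs = card A" using that length_arrangements by blast
      hence *: "length (take a zs) = a" using a by simp
      have "distinct zs" using that by (auto simp: arrangements_def)
      hence "card (set (take a zs)) = a" using * by (simp add: distinct_card)
      moreover have "set (take a zs) \<subseteq> A \<and> take a zs \<in> arrangements (set (take a zs)) S \<and>
          drop a zs \<in> arrangements (A - set (take a zs)) {}"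
        using append_mem_arrangements_iff[of S "take a zs" "drop a zs" A] that S *
        by (simp del: length_take)
      ultimately show ?thesis using assms(1) by (simp add: arrangements_empty)
    qed
    show "\<forall>zs\<in>?X. ?app (?split zs) = zs"
    proof
      fix zs assume "zs \<in> ?X"
      hence "drop a zs = rev (sorted_list_of_set (A - set (take a zs)))" using split by blast
      thus "?app (?split zs) = zs" using append_take_drop_id[of a zs] by simp
    qed
    show "?split ` ?X \<subseteq> ?Q"
    proof (rule image_subsetI)
      fix zs assume "zs \<in> ?X"
      from split[OF this] show "?split zs \<in> ?Q"
        by (simp only: mem_Sigma_iff mem_Collect_eq simp_thms)
    qed
    have Q: "length xs = a \<and> set xs = B" if "(B, xs) \<in> ?Q" for B xs
    proof -
      have "xs \<in> arrangements B S" "card B = a" using that by blast+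
      moreover from this have "set xs = B" by (simp add: arrangements_def)
      ultimately show ?thesis using length_arrangements by blast
    qed
    show "\<forall>z\<in>?Q. ?split (?app z) = z" using Q by auto
    show "?app ` ?Q \<subseteq> ?X"
    proof (rule image_subsetI)
      fix z assume "z \<in> ?Q"
      then obtain B xs where z: "z = (B, xs)" and B: "B \<subseteq> A" and xs: "xs \<in> arrangements B S"
        and *: "length xs = a" "set xs = B"
        using Q by blast
      have "rev (sorted_list_of_set (A - B)) \<in> arrangements (A - set xs) {}"
        using assms(1) * by (simp add: arrangements_empty)
      moreover have "set xs \<subseteq> A" "xs \<in> arrangements (set xs) S" "S \<subseteq> {1..<length xs}"
        using B xs * S by simp_all
      ultimately have "xs @ rev (sorted_list_of_set (A - B)) \<in>
          arrangements A S \<union> arrangements A (insert (length xs) S)"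
        using append_mem_arrangements_iff by blast
      thus "?app z \<in> ?X" using *(1) z by simp
    qed
  qed
  hence "card ?X = card ?Q" by (rule bij_betw_same_card)
  also have "\<dots> = (\<Sum>B\<in>?P. card (arrangements B S))"
    using fin assms(1) by (intro card_SigmaI) (auto intro: finite_arrangements finite_subset)
  also have "\<dots> = (\<Sum>B\<in>?P. card (arrangements {..<a} S))"
  proof (rule sum.cong[OF refl])
    fix B assume "B \<in> ?P"
    hence "finite B" "card B = a" using assms(1) by (auto intro: finite_subset)
    thus "card (arrangements B S) = card (arrangements {..<a} S)"
      using card_arrangements_lessThan[of B S] by simp
  qed
  also have "\<dots> = (card A choose a) * card (arrangements {..<a} S)"
    using assms(1) by (simp add: n_subsets)
  finally show ?thesis
    using disj assms(1) by (simp add: card_Un_disjoint finite_arrangements)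
qed

text \<open>The terms with index \<open>j\<close> and \<open>j + 1\<close> share the count of arrangements with ascent set
  \<open>{a\<^sub>1, \<dots>, a\<^sub>j}\<close>, so the alternating sum telescopes.\<close>

lemma alternating_sum_arrangements:
  fixes a :: "nat \<Rightarrow> nat"
  defines "d \<equiv> \<lambda>i. card (arrangements {..<a i} (a ` {1..<i}))"
  assumes a0: "a 0 = 0" and mono: "strict_mono_on {..i} a" and "r < i"
  shows "(\<Sum>j\<le>r. (-1) ^ j * int (a i choose a j) * int (d j)) =
    (-1) ^ r * int (card (arrangements {..<a i} (a ` {1..r})))"
  using \<open>r < i\<close>
proof (induction r)
  case 0
  thus ?case by (simp add: d_def a0 arrangements_empty)
next
  case (Suc r)
  have less: "a x < a y" if "x < y" "y \<le> i" for x y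
    using strict_mono_onD[OF mono, of x y] that by auto
  have ins: "a ` {1..Suc r} = insert (a (Suc r)) (a ` {1..r})"
    by (auto simp: atLeastAtMostSuc_conv)
  have "card (arrangements {..<a i} (a ` {1..r})) +
      card (arrangements {..<a i} (a ` {1..Suc r})) = (a i choose a (Suc r)) * d (Suc r)"
    unfolding ins d_def atLeastLessThanSuc_atLeastAtMost
    using less[of 0 "Suc r"] less[of "Suc r" i] Suc.prems less[of 0] less[of _ "Suc r"] a0
    by (subst card_arrangements_insert) (auto simp: Suc_le_eq)
  hence "int (a i choose a (Suc r)) * int (d (Suc r)) =
      int (card (arrangements {..<a i} (a ` {1..r}))) +
      int (card (arrangements {..<a i} (a ` {1..Suc r})))"
    by (metis of_nat_add of_nat_mult)
  hence step: "(-1) ^ Suc r * int (a i choose a (Suc r)) * int (d (Suc r)) =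
      - ((-1) ^ r * int (card (arrangements {..<a i} (a ` {1..r})))) +
      (-1) ^ Suc r * int (card (arrangements {..<a i} (a ` {1..Suc r})))"
    by (simp add: mult.assoc distrib_left)
  have IH: "(\<Sum>j\<le>r. (-1) ^ j * int (a i choose a j) * int (d j)) =
      (-1) ^ r * int (card (arrangements {..<a i} (a ` {1..r})))"
    using Suc by simp
  show ?case unfolding sum.atMost_Suc IH step by (rule add_minus_cancel)
qed

section \<open>The determinant\<close>

text \<open>Multiplying by the unitriangular matrix whose first column is \<open>(-1)\<^sup>j d\<^sub>j\<close> clears the first
  column except for its last entry, and the minor of that entry is unitriangular. Its cofactor
  sign \<open>(-1)\<^sup>m\<close> is the one in the conclusion.\<close>

lemma det_Hessenberg:
  fixes c :: "nat \<Rightarrow> nat \<Rightarrow> 'a :: comm_ring_1"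
  assumes one: "\<And>i. i < m \<Longrightarrow> c i (Suc i) = 1"
    and zero: "\<And>i j. Suc i < j \<Longrightarrow> j \<le> m \<Longrightarrow> c i j = 0"
    and d0: "d 0 = 1"
    and kernel: "\<And>i. i < m \<Longrightarrow> (\<Sum>j\<le>Suc i. (-1) ^ j * c i j * d j) = 0"
  shows "det (mat (Suc m) (Suc m) (\<lambda>(i, j). c i j)) =
    (-1) ^ m * (\<Sum>j\<le>m. (-1) ^ j * c m j * d j)"
proof -
  define M where "M = mat (Suc m) (Suc m) (\<lambda>(i, j). c i j)"
  define U where "U = mat (Suc m) (Suc m)
    (\<lambda>(i, j). if j = 0 then (-1) ^ i * d i else if i = j then 1 else 0)"
  define x where "x = (\<Sum>j\<le>m. (-1) ^ j * c m j * d j)"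
  have M: "M \<in> carrier_mat (Suc m) (Suc m)" and U: "U \<in> carrier_mat (Suc m) (Suc m)"
    by (auto simp: M_def U_def)
  have MU: "M * U \<in> carrier_mat (Suc m) (Suc m)" using M U by simp
  have detU: "det U = 1"
    by (subst det_lower_triangular[OF _ U])
      (auto simp: U_def d0 prod_list_diag_prod intro!: prod.neutral)
  \<comment> \<open>only column 0 of \<open>M\<close> is altered by \<open>U\<close>; the relations \<open>kernel\<close> say what it becomes\<close>
  have entry: "(M * U) $$ (i, j) = (\<Sum>l\<le>m. c i l * U $$ (l, j))" if "i \<le> m" "j \<le> m" for i j
    using that by (simp add: M_def U_def scalar_prod_def atLeast0LessThan lessThan_Suc_atMost)
  have col0: "(M * U) $$ (i, 0) = (if i = m then x else 0)" if "i \<le> m" for i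
  proof -
    have "(M * U) $$ (i, 0) = (\<Sum>l\<le>m. (-1) ^ l * c i l * d l)"
      using entry[OF that, of 0] by (simp add: U_def algebra_simps)
    also have "\<dots> = (\<Sum>l\<le>Suc i. (-1) ^ l * c i l * d l)" if "i < m"
      using that zero by (intro sum.mono_neutral_right) auto
    ultimately show ?thesis using that kernel[of i] by (cases "i = m") (auto simp: x_def)
  qed
  have col: "(M * U) $$ (i, Suc j) = c i (Suc j)" if "i \<le> m" "Suc j \<le> m" for i j
  proof -
    have "(M * U) $$ (i, Suc j) = (\<Sum>l\<le>m. if l = Suc j then c i l else 0)"
      unfolding entry[OF that] using that by (intro sum.cong) (auto simp: U_def)
    thus ?thesis using that by (simp add: sum.delta)
  qed
  have minor: "det (mat_delete (M * U) m 0) = 1"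
  proof -
    have D: "mat_delete (M * U) m 0 = mat m m (\<lambda>(i, j). c i (Suc j))"
      using MU M U by (intro eq_matI) (auto simp: mat_delete_def col simp del: index_mult_mat(1))
    show ?thesis unfolding D
      by (subst det_lower_triangular[of m])
        (auto simp: one zero prod_list_diag_prod intro!: prod.neutral)
  qed
  have "det M = det (M * U)" by (simp add: det_mult[OF M U] detU)
  also have "\<dots> = (\<Sum>i<Suc m. (M * U) $$ (i, 0) * cofactor (M * U) i 0)"
    by (rule laplace_expansion_column[OF MU]) simp
  also have "\<dots> = (\<Sum>i<Suc m. if i = m then x * cofactor (M * U) m 0 else 0)"
    using col0 by (intro sum.cong) auto
  also have "\<dots> = (-1) ^ m * x" by (simp add: cofactor_def minor)
  finally show ?thesis by (simp add: M_def x_def)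
qed

lemma det_binomial_eq_card_arrangements:
  fixes a :: "nat \<Rightarrow> nat"
  assumes a0: "a 0 = 0" and mono: "strict_mono_on {..Suc m} a"
  shows "det (mat (Suc m) (Suc m) (\<lambda>(i, j). int (a (Suc i) choose a j))) =
    int (card (arrangements {..<a (Suc m)} (a ` {1..m})))"
proof -
  define d where "d = (\<lambda>i. card (arrangements {..<a i} (a ` {1..<i})))"
  have alt: "(\<Sum>j\<le>i. (-1) ^ j * int (a (Suc i) choose a j) * int (d j)) = (-1) ^ i * int (d (Suc i))"
    if "i \<le> m" for i
    unfolding d_def atLeastLessThanSuc_atLeastAtMost
  proof (rule alternating_sum_arrangements[where a = a])
    show "strict_mono_on {..Suc i} a" by (rule monotone_on_subset[OF mono]) (use that in auto)
  qed (simp_all add: a0)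
  have less: "a x < a y" if "x < y" "y \<le> Suc m" for x y
    using strict_mono_onD[OF mono, of x y] that by auto
  have "det (mat (Suc m) (Suc m) (\<lambda>(i, j). int (a (Suc i) choose a j))) =
      (-1) ^ m * (\<Sum>j\<le>m. (-1) ^ j * int (a (Suc m) choose a j) * int (d j))"
  proof (rule det_Hessenberg)
    show "int (d 0) = 1" by (simp add: d_def a0 arrangements_empty)
    show "(\<Sum>j\<le>Suc i. (-1) ^ j * int (a (Suc i) choose a j) * int (d j)) = 0" if "i < m" for i
      using alt[of i] that by simp
  qed (use less in \<open>auto simp: binomial_eq_0\<close>)
  also have "\<dots> = int (d (Suc m))"
    unfolding alt[OF order_refl] by simp
  finally show ?thesis unfolding d_def atLeastLessThanSuc_atLeastAtMost .
qed

section \<open>The index as a binary expansion of the ascent set\<close>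

text \<open>The digits run from the most significant one, hence bit \<open>j\<close> belongs to position \<open>n - 1 - j\<close>.\<close>

lemma bit_perm_index: "bit (perm_index n p) j \<longleftrightarrow> j < n - 1 \<and> p (n - 1 - j) < p (n - j)"
proof -
  let ?b = "\<lambda>j. p (n - 1 - j) < p (n - j)"
  have "perm_index n p = (\<Sum>j = 0..<n - 1. of_bool (?b j) * 2 ^ j)"
    unfolding perm_index_def
    by (rule sum.reindex_bij_witness[where i = "\<lambda>j. n - 1 - j" and j = "\<lambda>i. n - 1 - i"])
      (auto simp: ascent_digit_def)
  also have "\<dots> = horner_sum of_bool 2 (map ?b [0..<n - 1])"
    by (simp add: horner_sum_eq_sum)
  finally show ?thesis by (auto simp: bit_horner_sum_bit_iff)
qed

lemma perm_index_eq_iff: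
  assumes "k < 2 ^ (n - 1)"
  shows "perm_index n p = k \<longleftrightarrow> (\<forall>i\<in>{1..n - 1}. p i < p (i + 1) \<longleftrightarrow> bit k (n - 1 - i))"
proof
  assume "perm_index n p = k"
  thus "\<forall>i\<in>{1..n - 1}. p i < p (i + 1) \<longleftrightarrow> bit k (n - 1 - i)"
    by (auto simp: bit_perm_index Suc_diff_le)
next
  assume R: "\<forall>i\<in>{1..n - 1}. p i < p (i + 1) \<longleftrightarrow> bit k (n - 1 - i)"
  show "perm_index n p = k"
  proof (rule bit_eqI)
    fix j
    show "bit (perm_index n p) j \<longleftrightarrow> bit k j"
    proof (cases "j < n - 1")
      case True
      hence "n - 1 - j \<in> {1..n - 1}" "n - 1 - (n - 1 - j) = j" "n - 1 - j + 1 = n - j" by auto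
      thus ?thesis using R True by (metis bit_perm_index)
    next
      case False
      hence "take_bit (n - 1) k = k" using assms by (simp add: take_bit_nat_eq_self)
      hence "\<not> bit k j" using False by (metis bit_take_bit_iff)
      thus ?thesis using False by (simp add: bit_perm_index)
    qed
  qed
qed

lemma perms_with_index_eq_card_arrangements:
  assumes k: "k < 2 ^ (n - 1)"
    and S: "\<And>i. i \<in> {1..n - 1} \<Longrightarrow> i \<in> S \<longleftrightarrow> bit k (n - 1 - i)"
  shows "perms_with_index n k = card (arrangements {1..n} S)"
proof -
  let ?word = "\<lambda>p. map p [1..<Suc n]"
  let ?P = "{p. p permutes {1..n} \<and> perm_index n p = k}"
  have iff: "?word p \<in> arrangements {1..n} S \<longleftrightarrow> perm_index n p = k" if "p permutes {1..n}" for p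
  proof -
    have "distinct (?word p)" "set (?word p) = {1..n}"
      using permutes_inj_on[OF that] permutes_image[OF that]
      by (auto simp: distinct_map atLeastLessThanSuc_atLeastAtMost simp del: upt_Suc)
    hence "?word p \<in> arrangements {1..n} S \<longleftrightarrow>
        (\<forall>i. Suc i < n \<longrightarrow> (p (Suc i) < p (Suc (Suc i)) \<longleftrightarrow> Suc i \<in> S))"
      by (simp add: arrangements_def del: upt_Suc)
    also have "\<dots> \<longleftrightarrow> (\<forall>i\<in>{1..n - 1}. p i < p (i + 1) \<longleftrightarrow> i \<in> S)"
      unfolding image_Suc_lessThan[symmetric] by (auto simp: less_diff_conv)
    also have "\<dots> \<longleftrightarrow> perm_index n p = k" using S by (simp add: perm_index_eq_iff[OF k])
    finally show ?thesis .
  qed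
  have "bij_betw ?word ?P (arrangements {1..n} S)"
  proof (rule bij_betw_imageI)
    show "inj_on ?word ?P"
    proof (rule inj_onI)
      fix p q assume *: "p \<in> ?P" "q \<in> ?P" "?word p = ?word q"
      have "p i = q i" for i
      proof (cases "i \<in> {1..n}")
        case True
        thus ?thesis using *(3) by (simp del: upt_Suc)
      next
        case False
        thus ?thesis using * permutes_not_in by (metis (mono_tags, lifting) mem_Collect_eq)
      qed
      thus "p = q" by blast
    qed
    show "?word ` ?P = arrangements {1..n} S"
    proof (intro equalityI subsetI)
      fix xs assume "xs \<in> ?word ` ?P"
      thus "xs \<in> arrangements {1..n} S" using iff by blast
    next
      fix xs assume xs: "xs \<in> arrangements {1..n} S"
      have len: "length xs = n" using length_arrangements[OF xs] by simp
      have dist: "distinct xs" "set xs = {1..n}" using xs by (auto simp: arrangements_def)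
      define p where "p = (\<lambda>i. if i \<in> {1..n} then xs ! (i - 1) else i)"
      have word: "?word p = xs"
        by (rule nth_equalityI) (auto simp: p_def len simp del: upt_Suc)
      have "p permutes {1..n}"
      proof (rule bij_imp_permutes)
        have "inj_on p {1..n}"
          using dist(1) len by (auto simp: p_def inj_on_def nth_eq_iff_index_eq)
        moreover have "p ` {1..n} = set (?word p)"
          by (simp add: atLeastLessThanSuc_atLeastAtMost del: upt_Suc)
        ultimately show "bij_betw p {1..n} {1..n}"
          unfolding word dist(2) by (simp add: bij_betw_def)
      qed (auto simp: p_def)
      thus "xs \<in> ?word ` ?P" using iff[of p] word xs by auto
    qed
  qed
  thus ?thesis unfolding perms_with_index_def by (rule bij_betw_same_card)
qed

section \<open>The count as a determinant\<close>

theorem theorem3: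
  fixes n t k m :: nat and s :: "nat \<Rightarrow> nat"
  assumes "t \<ge> 1"
    and "2 ^ (t - 1) \<le> k" and "k < 2 ^ t"
    and "n \<ge> t + 1"
    and "strict_mono_on {1..m} s"
    and "s ` {1..m} = {i \<in> {1..t}. bit k (t - i)}"
  shows "int (perms_with_index n k) = det (index_matrix n t m s)"
proof -
  \<comment> \<open>place \<open>s i\<close> of the block of \<open>t\<close> digits is position \<open>n - t - 1 + s i\<close> among all \<open>n - 1\<close> digits\<close>
  define a where "a = (\<lambda>i. if i = 0 then 0 else if i = Suc m then n else n - t - 1 + s i)"
  have s: "1 \<le> s i" "s i \<le> t" if "i \<in> {1..m}" for i using assms(6) that by auto
  have s_mono: "s i < s j" if "i \<in> {1..m}" "j \<in> {1..m}" "i < j" for i j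
    using strict_mono_onD[OF assms(5) that] .
  have a0: "a 0 = 0" and an: "a (Suc m) = n" by (auto simp: a_def)
  have mono: "strict_mono_on {..Suc m} a"
  proof (rule strict_mono_onI)
    fix i j assume *: "i \<in> {..Suc m}" "j \<in> {..Suc m}" "i < j"
    show "a i < a j"
    proof (cases "j = Suc m")
      case True
      thus ?thesis using * s(2)[of i] assms(4) by (cases "i = 0") (auto simp: a_def)
    next
      case False
      thus ?thesis using * s(1)[of j] s_mono[of i j] by (cases "i = 0") (auto simp: a_def)
    qed
  qed
  \<comment> \<open>\<open>index_matrix_entry\<close> has the complementary lower index \<open>a (Suc i) - a j\<close>\<close>
  have entry: "index_matrix_entry n t m s (i + 1) (j + 1) = a (Suc i) choose a j"
    if "i \<le> m" "j \<le> m" for i j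
  proof (cases "j = 0")
    case True
    thus ?thesis by (simp add: index_matrix_entry_def a0)
  next
    case False
    hence j: "j \<in> {1..m}" using that by simp
    have aj: "a j = n - t - 1 + s j" using j by (simp add: a_def)
    show ?thesis
    proof (cases "i = m")
      case True
      have "n - (t + 1 - s j) = a j" "t + 1 - s j \<le> n"
        using s[OF j] assms(4) by (auto simp: aj)
      hence "n choose (t + 1 - s j) = n choose a j" by (metis binomial_symmetric)
      thus ?thesis using True False by (simp add: index_matrix_entry_def an)
    next
      case False
      hence i: "Suc i \<in> {1..m}" using that by simp
      have ai: "a (Suc i) = n - t - 1 + s (Suc i)" using i by (simp add: a_def)
      show ?thesis
      proof (cases "j \<le> Suc i")
        case True
        hence "s j \<le> s (Suc i)" using s_mono[OF j i] by (cases "j = Suc i") auto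
        hence "a (Suc i) - (s (Suc i) - s j) = a j" "s (Suc i) - s j \<le> a (Suc i)"
          by (auto simp: ai aj)
        hence "a (Suc i) choose (s (Suc i) - s j) = a (Suc i) choose a j"
          by (metis binomial_symmetric)
        moreover have "n - t + s (Suc i) - 1 = a (Suc i)" using s[OF i] assms(4) by (simp add: ai)
        moreover have "j \<noteq> 0" using j by simp
        ultimately show ?thesis using True False that
          by (cases "j = Suc i") (auto simp: index_matrix_entry_def)
      next
        case False
        hence "a (Suc i) < a j" using strict_mono_onD[OF mono, of "Suc i" j] that by simp
        thus ?thesis using False \<open>i \<noteq> m\<close> \<open>j \<noteq> 0\<close> that
          by (simp add: index_matrix_entry_def binomial_eq_0)
      qed
    qed
  qed
  have "index_matrix n t m s = mat (Suc m) (Suc m) (\<lambda>(i, j). int (a (Suc i) choose a j))"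
    unfolding index_matrix_def by (rule eq_matI) (use entry in auto)
  hence "det (index_matrix n t m s) = int (card (arrangements {..<n} (a ` {1..m})))"
    using det_binomial_eq_card_arrangements[OF a0 mono] by (simp add: an)
  moreover have "perms_with_index n k = card (arrangements {1..n} (a ` {1..m}))"
  proof (rule perms_with_index_eq_card_arrangements)
    have "(2::nat) ^ t \<le> 2 ^ (n - 1)" using assms(4) by (intro power_increasing) auto
    thus "k < 2 ^ (n - 1)" using assms(3) by (rule less_le_trans[rotated])
  next
    fix i assume i: "i \<in> {1..n - 1}"
    have shift: "x \<in> (+) c ` T \<longleftrightarrow> c \<le> x \<and> x - c \<in> T" for x c :: nat and T
      by (metis imageE image_eqI add_diff_cancel_left' le_add1 le_add_diff_inverse)
    have "a ` {1..m} = (+) (n - t - 1) ` s ` {1..m}"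
      unfolding image_image by (rule image_cong) (auto simp: a_def)
    hence "i \<in> a ` {1..m} \<longleftrightarrow> n - t - 1 \<le> i \<and>
        i - (n - t - 1) \<in> {i \<in> {1..t}. bit k (t - i)}"
      by (simp only: shift assms(6))
    also have "\<dots> \<longleftrightarrow> n - t \<le> i \<and> bit k (t - (i - (n - t - 1)))"
      using i assms(4) by auto
    finally have "i \<in> a ` {1..m} \<longleftrightarrow> n - t \<le> i \<and> bit k (t - (i - (n - t - 1)))" .
    moreover have "\<not> bit k (n - 1 - i)" if "i < n - t"
    proof -
      have "t \<le> n - 1 - i" using that by simp
      moreover have "take_bit t k = k" using assms(3) by (simp add: take_bit_nat_eq_self)
      ultimately show ?thesis by (metis bit_take_bit_iff not_le)
    qed
    moreover have "t - (i - (n - t - 1)) = n - 1 - i" if "n - t \<le> i"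
      using that i assms(4) by auto
    ultimately show "i \<in> a ` {1..m} \<longleftrightarrow> bit k (n - 1 - i)" by (metis not_le)
  qed
  moreover have "card (arrangements {1..n} (a ` {1..m})) = card (arrangements {..<n} (a ` {1..m}))"
    using card_arrangements_lessThan[of "{1..n}"] by simp
  ultimately show ?thesis by simp
qed

end
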